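(* (Weight principle) Let $\mathcal{R}$ be an operator on a finite dimensional vector space with real eigenvalues. Let $\Omega>0$ and $\mathcal{S}$ be a highest weight and a total weight. Then: (a) $[\mathcal{R},\Omega,\mathcal{S}]>0$ if and only if $[\mathcal{R},1,\frac{\mathcal{S}}{\Omega}]>0$ if and only if $\mathcal{R}$ is $\frac{\mathcal{S}}{\Omega}$-positive. (b) $[\mathcal{R},\Omega,\mathcal{S}]\ge0$ if and only if $[\mathcal{R},1,\frac{\mathcal{S}}{\Omega}]\ge0$ if and only if $\mathcal{R}$ is $\frac{\mathcal{S}}{\Omega}$-nonnegative. (c) Let $\kappa\in\mathbb{R}$. Then $[\mathcal{R},\Omega,\mathcal{S}]\ge\mathcal{S}\kappa$ if and only if $[\mathcal{R},1,\frac{\mathcal{S}}{\Omega}]\ge\kappa\frac{\mathcal{S}}{\Omega}$. (d) Let $k'<k$. If $\mathcal{R}$ is $k'$-nonnegative, then $\mathcal{R}$ is $k$-positive or $1$-nonnegative.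
   Context: Let $\lambda_1\le\dots\le\lambda_N$ be the eigenvalues of $\mathcal{R}$, counted with multiplicity ($N$ the dimension of the space). For weights $\omega_1,\dots,\omega_N\ge0$, the highest weight is $\Omega=\max_i\omega_i$ and the total weight is $\mathcal{S}=\sum_i\omega_i$; a pair $(\Omega,\mathcal{S})$ with $\Omega>0$ arises this way iff $\Omega\le\mathcal{S}\le N\Omega$. The symbol $[\mathcal{R},\Omega,\mathcal{S}]$ denotes any weighted sum $\sum_i\omega_i\lambda_i$ with highest weight $\Omega$ and total weight $\mathcal{S}$. For $c\in\mathbb{R}$, $[\mathcal{R},\Omega,\mathcal{S}]\ge c$ (resp. $>c$) means that every sum $\sum_i\omega_i\lambda_i$ with $\omega_i\ge0$, $\max_i\omega_i=\Omega$, $\sum_i\omega_i=\mathcal{S}$ satisfies $\sum_i\omega_i\lambda_i\ge c$ (resp. $>c$). For real $k$ with $1\le k\le N$, $\mathcal{R}$ is $k$-nonnegative (resp. $k$-positive) if $\lambda_1+\dots+\lambda_{\lfloor k\rfloor}+(k-\lfloor k\rfloor)\lambda_{\lfloor k\rfloor+1}\ge0$ (resp. $>0$), where the last term is $0$ if $k$ is an integer. In (d), $1\le k'<k\le N$. *)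

theory Defs
  imports Complex_Main "HOL-Library.Multiset"
begin

text \<open>
  An operator is a linear endomorphism \<open>R\<close> of a finite-dimensional vector space, given by its scalar
  multiplication \<open>scale\<close>. The scalars range over \<open>real_field\<close>, so that both real and complex
  vector spaces are covered; a real number \<open>c\<close> is then the scalar \<open>of_real c\<close>.
\<close>

abbreviation space_dim :: "('f::field \<Rightarrow> 'v::ab_group_add \<Rightarrow> 'v) \<Rightarrow> nat"
  where "space_dim scale \<equiv> vector_space.dim scale UNIV"

definition real_eigenvalue_set ::
    "('f::real_field \<Rightarrow> 'v::ab_group_add \<Rightarrow> 'v) \<Rightarrow> ('v \<Rightarrow> 'v) \<Rightarrow> real set"
  where "real_eigenvalue_set scale R = {c. \<exists>v. v \<noteq> 0 \<and> R v = scale (of_real c) v}"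

text \<open>Algebraic multiplicity: the dimension of the generalized eigenspace.\<close>

definition eigenvalue_mult ::
    "('f::real_field \<Rightarrow> 'v::ab_group_add \<Rightarrow> 'v) \<Rightarrow> ('v \<Rightarrow> 'v) \<Rightarrow> real \<Rightarrow> nat"
  where "eigenvalue_mult scale R c =
    vector_space.dim scale
      {v. ((\<lambda>u. R u - scale (of_real c) u) ^^ space_dim scale) v = 0}"

definition real_eigenvalues ::
    "('f::real_field \<Rightarrow> 'v::ab_group_add \<Rightarrow> 'v) \<Rightarrow> ('v \<Rightarrow> 'v) \<Rightarrow> real multiset"
  where "real_eigenvalues scale R =
    (\<Sum>c\<in>real_eigenvalue_set scale R. replicate_mset (eigenvalue_mult scale R c) c)"

text \<open>
  All eigenvalues are real: the real ones, counted with multiplicity, already exhaust the dimension,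
  i.e. the characteristic polynomial is a product of linear factors with real roots. Over the reals
  this excludes rotations, for example; over the complex numbers it says that every eigenvalue is real.
\<close>

definition has_real_eigenvalues ::
    "('f::real_field \<Rightarrow> 'v::ab_group_add \<Rightarrow> 'v) \<Rightarrow> ('v \<Rightarrow> 'v) \<Rightarrow> bool"
  where "has_real_eigenvalues scale R \<longleftrightarrow> size (real_eigenvalues scale R) = space_dim scale"

text \<open>The \<open>i\<close>-th smallest eigenvalue, with \<open>i\<close> counted from 1.\<close>

definition eigval ::
    "('f::real_field \<Rightarrow> 'v::ab_group_add \<Rightarrow> 'v) \<Rightarrow> ('v \<Rightarrow> 'v) \<Rightarrow> nat \<Rightarrow> real"
  where "eigval scale R i = sorted_list_of_multiset (real_eigenvalues scale R) ! (i - 1)"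

text \<open>\<open>N \<ge> 1\<close> is required because \<open>Max {}\<close> is unspecified.\<close>

definition weights :: "nat \<Rightarrow> real \<Rightarrow> real \<Rightarrow> (nat \<Rightarrow> real) \<Rightarrow> bool"
  where "weights N \<Omega> S w \<longleftrightarrow>
    1 \<le> N \<and> (\<forall>i\<in>{1..N}. 0 \<le> w i) \<and> Max (w ` {1..N}) = \<Omega> \<and> (\<Sum>i=1..N. w i) = S"

text \<open>\<open>[R, \<Omega>, S] \<ge> c\<close> and \<open>[R, \<Omega>, S] > c\<close>.\<close>

definition weighted_ge ::
    "('f::real_field \<Rightarrow> 'v::ab_group_add \<Rightarrow> 'v) \<Rightarrow> ('v \<Rightarrow> 'v) \<Rightarrow> real \<Rightarrow> real \<Rightarrow> real \<Rightarrow> bool"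
  where "weighted_ge scale R \<Omega> S c \<longleftrightarrow>
    (\<forall>w. weights (space_dim scale) \<Omega> S w \<longrightarrow>
      (\<Sum>i=1..space_dim scale. w i * eigval scale R i) \<ge> c)"

definition weighted_gt ::
    "('f::real_field \<Rightarrow> 'v::ab_group_add \<Rightarrow> 'v) \<Rightarrow> ('v \<Rightarrow> 'v) \<Rightarrow> real \<Rightarrow> real \<Rightarrow> real \<Rightarrow> bool"
  where "weighted_gt scale R \<Omega> S c \<longleftrightarrow>
    (\<forall>w. weights (space_dim scale) \<Omega> S w \<longrightarrow>
      (\<Sum>i=1..space_dim scale. w i * eigval scale R i) > c)"

text \<open>
  Meaningful for \<open>1 \<le> k \<le> space_dim scale\<close>. If \<open>k\<close> is an integer, the last term has
  coefficient 0; in particular the out-of-range value of \<open>eigval\<close> at \<open>k = space_dim scale\<close>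
  does not matter.
\<close>

definition partial_trace ::
    "('f::real_field \<Rightarrow> 'v::ab_group_add \<Rightarrow> 'v) \<Rightarrow> ('v \<Rightarrow> 'v) \<Rightarrow> real \<Rightarrow> real"
  where "partial_trace scale R k =
    (\<Sum>i=1..nat \<lfloor>k\<rfloor>. eigval scale R i)
      + (k - of_int \<lfloor>k\<rfloor>) * eigval scale R (nat \<lfloor>k\<rfloor> + 1)"

definition k_nonnegative ::
    "('f::real_field \<Rightarrow> 'v::ab_group_add \<Rightarrow> 'v) \<Rightarrow> ('v \<Rightarrow> 'v) \<Rightarrow> real \<Rightarrow> bool"
  where "k_nonnegative scale R k \<longleftrightarrow> partial_trace scale R k \<ge> 0"

definition k_positive ::
    "('f::real_field \<Rightarrow> 'v::ab_group_add \<Rightarrow> 'v) \<Rightarrow> ('v \<Rightarrow> 'v) \<Rightarrow> real \<Rightarrow> bool"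
  where "k_positive scale R k \<longleftrightarrow> partial_trace scale R k > 0"

end

theory Submission
  imports Defs
begin

text \<open>
  For increasing eigenvalues, a weighted sum with weights in \<open>[0, 1]\<close> and total weight \<open>k\<close> is smallest
  when the weights are packed onto the smallest eigenvalues; that minimum is the partial trace at \<open>k\<close>.
  Parts (a)--(c) follow by rescaling the weights by \<open>\<Omega>\<close>. For (d), mixing the optimal weights for \<open>1\<close>
  and \<open>k\<close> gives admissible weights for \<open>k'\<close> between them, so the partial trace is convex in \<open>k\<close>: it
  cannot be negative at \<open>1\<close>, nonnegative at \<open>k'\<close> and nonpositive at \<open>k\<close>.
\<close>

section \<open>Greedy weights and their minimality\<close>

text \<open>For \<open>k \<ge> 0\<close> this is the length of the overlap of
  \<open>[i - 1, i]\<close> with \<open>[0, k]\<close>: first ones, then the fractional part of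
  \<open>k\<close>, then zeros.\<close>

definition greedy_weight :: "real \<Rightarrow> nat \<Rightarrow> real"
  where "greedy_weight k i = max 0 (min 1 (k - (real i - 1)))"

lemma greedy_weight_bounds: "0 \<le> greedy_weight k i" "greedy_weight k i \<le> 1"
  by (auto simp: greedy_weight_def)

text \<open>Keeping \<open>l\<close> arbitrary serves two uses: constant \<open>1\<close> gives the
  total weight, the eigenvalues give the partial trace.\<close>

lemma sum_greedy_weight:
  fixes l :: "nat \<Rightarrow> real"
  assumes "0 \<le> k" "k \<le> real N"
  shows "(\<Sum>i=1..N. greedy_weight k i * l i)
    = (\<Sum>i=1..nat \<lfloor>k\<rfloor>. l i) + (k - of_int \<lfloor>k\<rfloor>) * l (nat \<lfloor>k\<rfloor> + 1)"
proof -
  define m where "m = nat \<lfloor>k\<rfloor>"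
  have fl: "of_int \<lfloor>k\<rfloor> = real m"
    using assms by (simp add: m_def)
  have mk: "real m \<le> k" "k < real m + 1"
    using fl by linarith+
  then have "m \<le> N"
    using assms by linarith
  have full: "(\<Sum>i=1..m. greedy_weight k i * l i) = (\<Sum>i=1..m. l i)"
    using mk by (intro sum.cong) (auto simp: greedy_weight_def)
  show ?thesis
  \<comment> \<open>For \<open>m = N\<close> the index \<open>m + 1\<close> is out of range, but
    then \<open>k = N\<close> and its coefficient is 0.\<close>
  proof (cases "m = N")
    case True
    then have "k = real m"
      using mk assms by linarith
    then show ?thesis
      using full fl True by (simp add: m_def[symmetric])
  next
    case False
    have "(\<Sum>i=1..N. greedy_weight k i * l i) = (\<Sum>i=1..Suc m. greedy_weight k i * l i)"
      using mk \<open>m \<le> N\<close> False by (intro sum.mono_neutral_right) (auto simp: greedy_weight_def)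
    also have "\<dots> = (\<Sum>i=1..m. l i) + greedy_weight k (Suc m) * l (Suc m)"
      using full by simp
    also have "greedy_weight k (Suc m) = k - of_int \<lfloor>k\<rfloor>"
      using mk fl by (simp add: greedy_weight_def)
    finally show ?thesis
      by (simp add: m_def)
  qed
qed

lemma sum_greedy_weight_const:
  assumes "0 \<le> k" "k \<le> real N"
  shows "(\<Sum>i=1..N. greedy_weight k i) = k"
  using sum_greedy_weight[OF assms, of "\<lambda>_. 1"] assms by simp

text \<open>An exchange argument around a pivot \<open>p\<close>: passing from greedy weights to
  \<open>w\<close> removes weight only where \<open>l i \<le> p\<close> and adds it only where
  \<open>l i \<ge> p\<close>; at the pivot index the change contributes nothing.\<close>

lemma greedy_weight_minimal:
  fixes l w :: "nat \<Rightarrow> real"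
  assumes "0 \<le> k" "k \<le> real N"
    and mono: "mono_on {1..N} l"
    and w: "\<And>i. i \<in> {1..N} \<Longrightarrow> 0 \<le> w i \<and> w i \<le> 1"
    and total: "(\<Sum>i=1..N. w i) = k"
  shows "(\<Sum>i=1..N. greedy_weight k i * l i) \<le> (\<Sum>i=1..N. w i * l i)"
proof -
  define m where "m = nat \<lfloor>k\<rfloor>"
  \<comment> \<open>The eigenvalue at which the greedy weights drop from \<open>1\<close> to \<open>0\<close>.\<close>
  define p where "p = l (min (Suc m) N)"
  have mk: "real m \<le> k" "k < real m + 1"
    using assms by (simp_all add: m_def)
  have "0 \<le> (w i - greedy_weight k i) * (l i - p)" if i: "i \<in> {1..N}" for i
  proof (cases "i \<le> m")
    case True
    then have "greedy_weight k i = 1"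
      using mk by (auto simp: greedy_weight_def)
    moreover have "l i \<le> p"
      unfolding p_def using True i by (intro mono_onD[OF mono]) auto
    ultimately show ?thesis
      using w[OF i] by (intro mult_nonpos_nonpos) auto
  next
    case False
    show ?thesis
    proof (cases "i = Suc m")
      case True
      then show ?thesis
        using i by (simp add: p_def min_def)
    next
      case neq: False
      then have "greedy_weight k i = 0"
        using False mk by (auto simp: greedy_weight_def)
      moreover have "p \<le> l i"
        unfolding p_def using neq False i by (intro mono_onD[OF mono]) auto
      ultimately show ?thesis
        using w[OF i] by simp
    qed
  qed
  then have "0 \<le> (\<Sum>i=1..N. (w i - greedy_weight k i) * (l i - p))"
    by (rule sum_nonneg)
  \<comment> \<open>The pivot enters only through the difference of the total weights, which is
    0.\<close>
  also have "\<dots> = (\<Sum>i=1..N. w i * l i) - (\<Sum>i=1..N. greedy_weight k i * l i)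
      - ((\<Sum>i=1..N. w i) - (\<Sum>i=1..N. greedy_weight k i)) * p"
    by (simp add: sum_subtractf sum_distrib_left[symmetric] algebra_simps sum.distrib)
  finally show ?thesis
    using total sum_greedy_weight_const[OF assms(1,2)] by simp
qed

section \<open>Admissible weights and rescaling\<close>

text \<open>Replaces \<open>Max\<close> by a bound that is attained; the existence of an attaining
  index also encodes \<open>1 \<le> N\<close>.\<close>

lemma weights_iff:
  "weights N \<Omega> S w \<longleftrightarrow>
    (\<forall>i\<in>{1..N}. 0 \<le> w i \<and> w i \<le> \<Omega>) \<and> (\<exists>i\<in>{1..N}. w i = \<Omega>) \<and> (\<Sum>i=1..N. w i) = S"
proof (cases "1 \<le> N")
  case True
  then show ?thesis
    by (auto simp: weights_def Max_eq_iff)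
qed (simp add: weights_def)

lemma weights_scale:
  assumes "0 < a" "weights N \<Omega> S w"
  shows "weights N (a * \<Omega>) (a * S) (\<lambda>i. a * w i)"
  using assms by (auto simp: weights_iff sum_distrib_left[symmetric])

lemma weights_total_bounds:
  assumes "weights N \<Omega> S w"
  shows "\<Omega> \<le> S" "S \<le> real N * \<Omega>"
proof -
  obtain i where "i \<in> {1..N}" "w i = \<Omega>"
    using assms by (auto simp: weights_iff)
  then show "\<Omega> \<le> S"
    using assms member_le_sum[of i "{1..N}" w] by (auto simp: weights_iff)
  show "S \<le> real N * \<Omega>"
    using assms sum_bounded_above[of "{1..N}" w \<Omega>] by (auto simp: weights_iff)
qed

text \<open>The bound \<open>1 \<le> k\<close> makes the first weight equal to 1, so the highest
  weight is attained.\<close>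

lemma weights_greedy_weight:
  assumes "1 \<le> k" "k \<le> real N"
  shows "weights N 1 k (greedy_weight k)"
proof -
  have "1 \<in> {1..N}" "greedy_weight k 1 = 1"
    using assms by (auto simp: greedy_weight_def)
  then show ?thesis
    using assms sum_greedy_weight_const[of k N]
    by (auto simp: weights_iff greedy_weight_bounds)
qed

text \<open>Multiplication by \<open>\<Omega>\<close> is a bijection between the two families of
  weights and scales each sum by \<open>\<Omega>\<close>.\<close>

lemma weighted_rescale:
  assumes "0 < \<Omega>"
  shows "weighted_ge scale R \<Omega> S (\<Omega> * c) \<longleftrightarrow> weighted_ge scale R 1 (S / \<Omega>) c"
    and "weighted_gt scale R \<Omega> S (\<Omega> * c) \<longleftrightarrow> weighted_gt scale R 1 (S / \<Omega>) c"
proof -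
  let ?N = "space_dim scale"
  let ?f = "\<lambda>w. \<Sum>i=1..?N. w i * eigval scale R i"
  have f: "?f (\<lambda>i. a * w i) = a * ?f w" for a :: real and w
    by (simp add: sum_distrib_left mult.assoc)
  \<comment> \<open>An arbitrary predicate \<open>P\<close> covers the weak and the strict bound at
    once.\<close>
  have "(\<forall>w. weights ?N \<Omega> S w \<longrightarrow> P (?f w)) \<longleftrightarrow> (\<forall>w. weights ?N 1 (S / \<Omega>) w \<longrightarrow> P (\<Omega> * ?f w))"
    (is "?L \<longleftrightarrow> ?R") for P
  proof
    assume L: ?L
    show ?R
    proof (intro allI impI)
      fix w
      assume "weights ?N 1 (S / \<Omega>) w"
      from weights_scale[OF assms this] have "weights ?N \<Omega> S (\<lambda>i. \<Omega> * w i)"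
        using assms by simp
      with L have "P (?f (\<lambda>i. \<Omega> * w i))"
        by blast
      then show "P (\<Omega> * ?f w)"
        by (simp only: f)
    qed
  next
    assume R: ?R
    show ?L
    proof (intro allI impI)
      fix w
      assume "weights ?N \<Omega> S w"
      from weights_scale[OF _ this, of "1 / \<Omega>"] have "weights ?N 1 (S / \<Omega>) (\<lambda>i. 1 / \<Omega> * w i)"
        using assms by simp
      with R have "P (\<Omega> * ?f (\<lambda>i. 1 / \<Omega> * w i))"
        by blast
      moreover have "\<Omega> * ?f (\<lambda>i. 1 / \<Omega> * w i) = ?f w"
        unfolding f using assms by simp
      ultimately show "P (?f w)"
        by simp
    qed
  qed
  note transfer = this
  show "weighted_ge scale R \<Omega> S (\<Omega> * c) \<longleftrightarrow> weighted_ge scale R 1 (S / \<Omega>) c"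
    unfolding weighted_ge_def using transfer[of "\<lambda>x. \<Omega> * c \<le> x"] assms by simp
  show "weighted_gt scale R \<Omega> S (\<Omega> * c) \<longleftrightarrow> weighted_gt scale R 1 (S / \<Omega>) c"
    unfolding weighted_gt_def using transfer[of "\<lambda>x. \<Omega> * c < x"] assms by simp
qed

section \<open>The partial trace as a minimum of weighted sums\<close>

text \<open>The hypothesis makes the sorted list of eigenvalues exactly as long as the dimension, so
  every index \<open>i - 1\<close> is in range.\<close>

lemma mono_on_eigval:
  assumes "has_real_eigenvalues scale R"
  shows "mono_on {1..space_dim scale} (eigval scale R)"
proof (rule mono_onI)
  fix i j
  assume "i \<in> {1..space_dim scale}" "j \<in> {1..space_dim scale}" "i \<le> j"
  moreover have "length (sorted_list_of_multiset (real_eigenvalues scale R)) = space_dim scale"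
    using assms by (metis has_real_eigenvalues_def mset_sorted_list_of_multiset size_mset)
  ultimately show "eigval scale R i \<le> eigval scale R j"
    unfolding eigval_def by (intro sorted_nth_mono) auto
qed

lemma partial_trace_le:
  assumes "has_real_eigenvalues scale R" "weights (space_dim scale) 1 k w"
  shows "partial_trace scale R k \<le> (\<Sum>i=1..space_dim scale. w i * eigval scale R i)"
proof -
  have k: "0 \<le> k" "k \<le> real (space_dim scale)"
    using weights_total_bounds[OF assms(2)] by simp_all
  show ?thesis
    using greedy_weight_minimal[OF k mono_on_eigval[OF assms(1)], of w] assms(2)
    unfolding partial_trace_def sum_greedy_weight[OF k, symmetric] weights_iff by blast
qed

lemma partial_trace_eq_greedy_sum:
  assumes "1 \<le> k" "k \<le> real (space_dim scale)"
  shows "partial_trace scale R k = (\<Sum>i=1..space_dim scale. greedy_weight k i * eigval scale R i)"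
  unfolding partial_trace_def using assms by (subst sum_greedy_weight) auto

text \<open>The partial trace is a lower bound attained by the greedy weights, so a weak or strict
  bound on all sums is the same bound on it.\<close>

lemma weighted_iff_partial_trace:
  assumes "has_real_eigenvalues scale R" "1 \<le> k" "k \<le> real (space_dim scale)"
  shows "weighted_ge scale R 1 k c \<longleftrightarrow> c \<le> partial_trace scale R k"
    and "weighted_gt scale R 1 k c \<longleftrightarrow> c < partial_trace scale R k"
proof -
  let ?g = "greedy_weight k"
  have least: "partial_trace scale R k \<le> (\<Sum>i=1..space_dim scale. w i * eigval scale R i)"
    if "weights (space_dim scale) 1 k w" for w
    by (rule partial_trace_le[OF assms(1) that])
  have attained: "weights (space_dim scale) 1 k ?g"
    "(\<Sum>i=1..space_dim scale. ?g i * eigval scale R i) = partial_trace scale R k"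
    by (rule weights_greedy_weight[OF assms(2,3)])
      (rule partial_trace_eq_greedy_sum[OF assms(2,3), symmetric])
  show "weighted_ge scale R 1 k c \<longleftrightarrow> c \<le> partial_trace scale R k"
    unfolding weighted_ge_def attained(2)[symmetric]
    using attained(1) least[folded attained(2)] by (blast intro: order_trans)
  show "weighted_gt scale R 1 k c \<longleftrightarrow> c < partial_trace scale R k"
    unfolding weighted_gt_def attained(2)[symmetric]
    using attained(1) least[folded attained(2)] by (blast intro: less_le_trans)
qed

section \<open>Convexity of the partial trace\<close>

lemma partial_trace_convex:
  assumes R: "has_real_eigenvalues scale R"
    and x: "1 \<le> x" "x \<le> real (space_dim scale)"
    and y: "1 \<le> y" "y \<le> real (space_dim scale)"
    and t: "0 \<le> t" "t \<le> 1"
  shows "partial_trace scale R ((1 - t) * x + t * y)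
    \<le> (1 - t) * partial_trace scale R x + t * partial_trace scale R y"
proof -
  let ?N = "space_dim scale"
  let ?w = "\<lambda>i. (1 - t) * greedy_weight x i + t * greedy_weight y i"
  \<comment> \<open>Both greedy weights equal 1 at index 1, so mixing them keeps the highest weight
    1.\<close>
  have "1 \<in> {1..?N}" "?w 1 = 1"
    using x y by (auto simp: greedy_weight_def)
  moreover have "0 \<le> ?w i \<and> ?w i \<le> 1" for i
    using t by (auto intro!: add_nonneg_nonneg mult_nonneg_nonneg convex_bound_le
        simp: greedy_weight_bounds)
  moreover have "(\<Sum>i=1..?N. ?w i) = (1 - t) * x + t * y"
    using x y sum_greedy_weight_const[of x ?N] sum_greedy_weight_const[of y ?N]
    by (simp add: sum.distrib sum_distrib_left[symmetric])
  ultimately have "weights ?N 1 ((1 - t) * x + t * y) ?w"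
    unfolding weights_iff by blast
  from partial_trace_le[OF R this] show ?thesis
    by (simp add: partial_trace_eq_greedy_sum x y sum.distrib sum_distrib_left distrib_right mult.assoc)
qed

lemma k_nonnegative_imp_positive_or_1_nonnegative:
  assumes R: "has_real_eigenvalues scale R"
    and k: "1 \<le> k'" "k' < k" "k \<le> real (space_dim scale)"
    and nonneg: "k_nonnegative scale R k'"
  shows "k_positive scale R k \<or> k_nonnegative scale R 1"
proof (rule ccontr)
  assume "\<not> ?thesis"
  then have neg: "partial_trace scale R k \<le> 0" "partial_trace scale R 1 < 0"
    by (auto simp: k_positive_def k_nonnegative_def)
  \<comment> \<open>The position of \<open>k'\<close> on the segment from 1 to \<open>k\<close>,
    where \<open>k > 1\<close>.\<close>
  define t where "t = (k' - 1) / (k - 1)"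
  have t: "0 \<le> t" "t < 1"
    using k by (auto simp: t_def)
  have "t * (k - 1) = k' - 1"
    using k by (simp add: t_def)
  then have "(1 - t) * 1 + t * k = k'"
    by (simp add: algebra_simps)
  then have "partial_trace scale R k' \<le> (1 - t) * partial_trace scale R 1 + t * partial_trace scale R k"
    using partial_trace_convex[OF R, of 1 k t] t k by simp
  \<comment> \<open>Strict because \<open>t < 1\<close> leaves a positive coefficient on the
    negative value at 1.\<close>
  also have "\<dots> < 0"
    using neg t by (intro add_neg_nonpos mult_pos_neg mult_nonneg_nonpos) auto
  finally show False
    using nonneg by (simp add: k_nonnegative_def)
qed

theorem theorem3p6:
  fixes scale :: "'f::real_field \<Rightarrow> 'v::ab_group_add \<Rightarrow> 'v"
    and Basis :: "'v set"
    and R :: "'v \<Rightarrow> 'v"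
  assumes "finite_dimensional_vector_space scale Basis"
    and "Vector_Spaces.linear scale scale R"
    and "has_real_eigenvalues scale R"
  shows
    "(\<forall>\<Omega> S. 0 < \<Omega> \<and> (\<exists>w. weights (space_dim scale) \<Omega> S w) \<longrightarrow>
        ((weighted_gt scale R \<Omega> S 0 \<longleftrightarrow> weighted_gt scale R 1 (S / \<Omega>) 0) \<and>
         (weighted_gt scale R 1 (S / \<Omega>) 0 \<longleftrightarrow> k_positive scale R (S / \<Omega>))) \<and>
        ((weighted_ge scale R \<Omega> S 0 \<longleftrightarrow> weighted_ge scale R 1 (S / \<Omega>) 0) \<and>
         (weighted_ge scale R 1 (S / \<Omega>) 0 \<longleftrightarrow> k_nonnegative scale R (S / \<Omega>))) \<and>
        (\<forall>\<kappa>::real. weighted_ge scale R \<Omega> S (S * \<kappa>) \<longleftrightarrow>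
           weighted_ge scale R 1 (S / \<Omega>) (\<kappa> * (S / \<Omega>)))) \<and>
     (\<forall>k' k :: real. 1 \<le> k' \<and> k' < k \<and> k \<le> real (space_dim scale) \<longrightarrow>
        k_nonnegative scale R k' \<longrightarrow> k_positive scale R k \<or> k_nonnegative scale R 1)"
proof (intro conjI allI impI)
  fix \<Omega> S :: real
  assume "0 < \<Omega> \<and> (\<exists>w. weights (space_dim scale) \<Omega> S w)"
  then obtain w where \<Omega>: "0 < \<Omega>" and w: "weights (space_dim scale) \<Omega> S w"
    by blast
  have s: "1 \<le> S / \<Omega>" "S / \<Omega> \<le> real (space_dim scale)"
    using weights_total_bounds[OF w] \<Omega> by (simp_all add: field_simps)
  note minimum = weighted_iff_partial_trace[OF assms(3) s]
  show "weighted_gt scale R \<Omega> S 0 \<longleftrightarrow> weighted_gt scale R 1 (S / \<Omega>) 0"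
    "weighted_ge scale R \<Omega> S 0 \<longleftrightarrow> weighted_ge scale R 1 (S / \<Omega>) 0"
    using weighted_rescale[OF \<Omega>, of scale R S 0] by simp_all
  show "weighted_gt scale R 1 (S / \<Omega>) 0 \<longleftrightarrow> k_positive scale R (S / \<Omega>)"
    "weighted_ge scale R 1 (S / \<Omega>) 0 \<longleftrightarrow> k_nonnegative scale R (S / \<Omega>)"
    using minimum by (simp_all add: k_positive_def k_nonnegative_def)
  show "weighted_ge scale R \<Omega> S (S * \<kappa>) \<longleftrightarrow> weighted_ge scale R 1 (S / \<Omega>) (\<kappa> * (S / \<Omega>))" for \<kappa>
    \<comment> \<open>With this threshold, \<open>\<Omega> * (\<kappa> * (S / \<Omega>))\<close> is
      \<open>S * \<kappa>\<close>.\<close>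
    using weighted_rescale(1)[OF \<Omega>, of scale R S "\<kappa> * (S / \<Omega>)"] \<Omega> by (simp add: mult.commute)
next
  fix k' k :: real
  assume "1 \<le> k' \<and> k' < k \<and> k \<le> real (space_dim scale)" "k_nonnegative scale R k'"
  then show "k_positive scale R k \<or> k_nonnegative scale R 1"
    using k_nonnegative_imp_positive_or_1_nonnegative[OF assms(3)] by blast
qed

end
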